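(* Let $\tilde{\mathbf s}=(\tilde s_1,\tilde s_2)$ be the vector associated with a nondegenerate quadrilateral $K$, let $\tilde K$ be the corresponding intermediate quadrilateral with edges $\tilde e_1,\dots,\tilde e_4$ and edge midpoints $\tilde{\mathbf m}_1,\dots,\tilde{\mathbf m}_4$, and let $\tilde c\in\mathbb R$. Then every $\tilde p\in\tilde P_{\tilde K}(\tilde c)=\operatorname{Span}\{1,\tilde x_1,\tilde x_2,\tilde\mu(\tilde x_1,\tilde x_2;\tilde c)\}$ satisfies the mean value property $$\frac1{|\tilde e_j|}\int_{\tilde e_j}\tilde p\,d\tilde\sigma=\tilde p(\tilde{\mathbf m}_j),\qquad j=1,2,3,4,$$ where $|\tilde e_j|$ is the length of $\tilde e_j$ and $d\tilde\sigma$ is arc length.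
   Context: Let $K\subset\mathbb R^2$ be a nondegenerate quadrilateral with consecutive vertices $\mathbf v_1,\mathbf v_2,\mathbf v_3,\mathbf v_4$. Put $A=\frac14(\mathbf v_1-\mathbf v_2-\mathbf v_3+\mathbf v_4,\ \mathbf v_1+\mathbf v_2-\mathbf v_3-\mathbf v_4)$ (a $2\times2$ matrix given by its two columns, assumed invertible), $\mathbf d=\frac14(\mathbf v_1-\mathbf v_2+\mathbf v_3-\mathbf v_4)$ and $\tilde{\mathbf s}=(\tilde s_1,\tilde s_2)=A^{-1}\mathbf d$. Let $\hat K=[-1,1]^2$ have vertices $\hat{\mathbf v}_1=(1,1)$, $\hat{\mathbf v}_2=(-1,1)$, $\hat{\mathbf v}_3=(-1,-1)$, $\hat{\mathbf v}_4=(1,-1)$. The intermediate quadrilateral is $\tilde K=\mathcal S_K(\hat K)$, where $\mathcal S_K(\hat{\mathbf x})=\hat{\mathbf x}+\hat x_1\hat x_2\tilde{\mathbf s}$; it has vertices $\tilde{\mathbf v}_1=\hat{\mathbf v}_1+\tilde{\mathbf s}$, $\tilde{\mathbf v}_2=\hat{\mathbf v}_2-\tilde{\mathbf s}$, $\tilde{\mathbf v}_3=\hat{\mathbf v}_3+\tilde{\mathbf s}$, $\tilde{\mathbf v}_4=\hat{\mathbf v}_4-\tilde{\mathbf s}$. Its edge $\tilde e_j$ is the segment joining $\tilde{\mathbf v}_{j-1}$ and $\tilde{\mathbf v}_j$ (with $\tilde{\mathbf v}_0:=\tilde{\mathbf v}_4$), of positive length. The midpoints of $\tilde e_1,\dots,\tilde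 e_4$ are $\tilde{\mathbf m}_1=(1,0)$, $\tilde{\mathbf m}_2=(0,1)$, $\tilde{\mathbf m}_3=(-1,0)$, $\tilde{\mathbf m}_4=(0,-1)$, the same as those of $\hat K$. For $\tilde c\in\mathbb R$ define the quartic polynomial $$\tilde\mu(\tilde x_1,\tilde x_2;\tilde c)=-\tfrac53\,\tilde\ell_1(\tilde{\mathbf x})\,\tilde\ell_2(\tilde{\mathbf x})\,\tilde{\mathscr Q}(\tilde{\mathbf x}),$$ where $$\tilde\ell_1(\tilde{\mathbf x})=\tilde x_1-\tilde x_2+\tilde s_2-\tilde s_1,\qquad \tilde\ell_2(\tilde{\mathbf x})=\tilde x_1+\tilde x_2+\tilde s_1+\tilde s_2,$$ $$\tilde{\mathscr Q}(\tilde{\mathbf x})=\left(\tilde x_1+\tfrac25\tilde s_2\right)^2+\left(\tilde x_2+\tfrac25\tilde s_1\right)^2-\tilde r^2+\tilde c\left[\left(\tilde x_1+\tfrac25\tilde s_2\right)\left(\tilde x_2+\tfrac25\tilde s_1\right)+\tfrac6{25}\tilde s_1\tilde s_2\right],$$ with $\tilde r^2:=\frac{6}{25}\left(\frac52-\tilde s_1^2-\tilde s_2^2\right)$. The span is the real linear span. *)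

theory Defs
  imports "HOL-Analysis.Analysis" "HOL-Library.Function_Algebras"
begin

text \<open>
  A quadrilateral is given by its consecutive vertices. Its boundary has to be a simple
  closed curve; convexity is not required. Nondegeneracy is expressed by the invertibility of
  the matrix with the two columns below. Collinearity of three consecutive vertices is not excluded.
\<close>

definition mat_K :: "real^2 \<Rightarrow> real^2 \<Rightarrow> real^2 \<Rightarrow> real^2 \<Rightarrow> real^2^2" where
  "mat_K v1 v2 v3 v4 = transpose (vector
     [(1/4) *\<^sub>R (v1 - v2 - v3 + v4), (1/4) *\<^sub>R (v1 + v2 - v3 - v4)])"

definition vec_d :: "real^2 \<Rightarrow> real^2 \<Rightarrow> real^2 \<Rightarrow> real^2 \<Rightarrow> real^2" where
  "vec_d v1 v2 v3 v4 = (1/4) *\<^sub>R (v1 - v2 + v3 - v4)"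

definition vec_s :: "real^2 \<Rightarrow> real^2 \<Rightarrow> real^2 \<Rightarrow> real^2 \<Rightarrow> real^2" where
  "vec_s v1 v2 v3 v4 = matrix_inv (mat_K v1 v2 v3 v4) *v vec_d v1 v2 v3 v4"

definition nondegenerate_quadrilateral ::
    "real^2 \<Rightarrow> real^2 \<Rightarrow> real^2 \<Rightarrow> real^2 \<Rightarrow> bool" where
  "nondegenerate_quadrilateral v1 v2 v3 v4 \<longleftrightarrow>
     simple_path (linepath v1 v2 +++ linepath v2 v3 +++ linepath v3 v4 +++ linepath v4 v1) \<and>
     invertible (mat_K v1 v2 v3 v4)"

text \<open>Vertex indices are read modulo 4, so that vertex 0 is vertex 4.\<close>

definition ref_vertex :: "nat \<Rightarrow> real^2" where
  "ref_vertex j =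
     [vector [1, -1], vector [1, 1], vector [-1, 1], vector [-1, -1]] ! (j mod 4)"

definition map_S :: "real^2 \<Rightarrow> real^2 \<Rightarrow> real^2" where
  "map_S s x = x + (x $ 1 * x $ 2) *\<^sub>R s"

definition int_vertex :: "real^2 \<Rightarrow> nat \<Rightarrow> real^2" where
  "int_vertex s j = map_S s (ref_vertex j)"

text \<open>The edge of index \<open>j \<ge> 1\<close> as a parametrized segment, its length and its midpoint.\<close>

definition int_edge :: "real^2 \<Rightarrow> nat \<Rightarrow> real \<Rightarrow> real^2" where
  "int_edge s j = linepath (int_vertex s (j - 1)) (int_vertex s j)"

definition int_edge_length :: "real^2 \<Rightarrow> nat \<Rightarrow> real" where
  "int_edge_length s j = dist (int_vertex s (j - 1)) (int_vertex s j)"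

definition int_midpoint :: "real^2 \<Rightarrow> nat \<Rightarrow> real^2" where
  "int_midpoint s j = midpoint (int_vertex s (j - 1)) (int_vertex s j)"

definition arclength_integral :: "(real \<Rightarrow> real^2) \<Rightarrow> (real^2 \<Rightarrow> real) \<Rightarrow> real" where
  "arclength_integral \<gamma> f = integral {0..1} (\<lambda>t. f (\<gamma> t) * norm (vector_derivative \<gamma> (at t)))"

definition ell1 :: "real^2 \<Rightarrow> real^2 \<Rightarrow> real" where
  "ell1 s x = x $ 1 - x $ 2 + s $ 2 - s $ 1"

definition ell2 :: "real^2 \<Rightarrow> real^2 \<Rightarrow> real" where
  "ell2 s x = x $ 1 + x $ 2 + s $ 1 + s $ 2"

definition r_squared :: "real^2 \<Rightarrow> real" where
  "r_squared s = 6/25 * (5/2 - (s $ 1)\<^sup>2 - (s $ 2)\<^sup>2)"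

definition quad_Q :: "real^2 \<Rightarrow> real \<Rightarrow> real^2 \<Rightarrow> real" where
  "quad_Q s c x =
     (x $ 1 + 2/5 * s $ 2)\<^sup>2 + (x $ 2 + 2/5 * s $ 1)\<^sup>2 - r_squared s
     + c * ((x $ 1 + 2/5 * s $ 2) * (x $ 2 + 2/5 * s $ 1) + 6/25 * s $ 1 * s $ 2)"

definition mu :: "real^2 \<Rightarrow> real \<Rightarrow> real^2 \<Rightarrow> real" where
  "mu s c x = - 5/3 * ell1 s x * ell2 s x * quad_Q s c x"

text \<open>Functions into the reals form a real vector space under the pointwise operations.\<close>

interpretation real_fun: vector_space "\<lambda>(a::real) (f::'a \<Rightarrow> real) x. a * f x"
  by unfold_locales (auto simp: fun_eq_iff algebra_simps)

definition space_P :: "real^2 \<Rightarrow> real \<Rightarrow> (real^2 \<Rightarrow> real) set" where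
  "space_P s c = real_fun.span {\<lambda>x. 1, \<lambda>x. x $ 1, \<lambda>x. x $ 2, mu s c}"

end

theory Submission
  imports Defs
begin

text \<open>
  Parametrize an edge by \<open>m + \<tau> h\<close> with \<open>\<tau> \<in> [-1, 1]\<close>, where \<open>m\<close> is its midpoint. The product of
  the two diagonal forms \<open>\<ell>\<^sub>1\<close>, \<open>\<ell>\<^sub>2\<close> vanishes at both end points, so it is a multiple of
  \<open>1 - \<tau>\<^sup>2\<close>, while the quadratic factor becomes \<open>q\<^sub>0 + q\<^sub>1 \<tau> + q\<^sub>2 \<tau>\<^sup>2\<close>. The mean of
  \<open>(1 - \<tau>\<^sup>2) (q\<^sub>0 + q\<^sub>1 \<tau> + q\<^sub>2 \<tau>\<^sup>2)\<close> is \<open>2/3 q\<^sub>0 + 2/15 q\<^sub>2\<close>, which equals the midpoint value \<open>q\<^sub>0\<close>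
  exactly when \<open>q\<^sub>2 = 5/2 q\<^sub>0\<close>; the constants in the quadratic factor are such that this holds on
  all four edges.
\<close>

text \<open>A segment with equal end points would be constant, so the path would take one value at
  two parameters. The joins nest to the right, so the segments occupy [0,1/2], [1/2,3/4], [3/4,7/8]
  and [7/8,1]; each sampled pair lies in one of them and avoids the pair 0, 1 exempted by
  \<open>loop_free\<close>.\<close>

lemma linepath_joins_distinct_vertices:
  assumes "simple_path (linepath v1 v2 +++ linepath v2 v3 +++ linepath v3 v4 +++ linepath v4 v1)"
    (is "simple_path ?g")
  shows "v1 \<noteq> v2" "v2 \<noteq> v3" "v3 \<noteq> v4" "v4 \<noteq> v1"
proof -
  have inj: "?g x \<noteq> ?g y" if "0 \<le> x" "x < y" "y < 1" for x y
    using assms that by (force simp: simple_path_def loop_free_def)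
  show "v1 \<noteq> v2"
    using inj[of 0 "1/4"] by (auto simp: joinpaths_def linepath_def algebra_simps
        simp flip: scaleR_add_left)
  show "v2 \<noteq> v3"
    using inj[of "9/16" "5/8"] by (auto simp: joinpaths_def linepath_def algebra_simps
        simp flip: scaleR_add_left)
  show "v3 \<noteq> v4"
    using inj[of "25/32" "13/16"] by (auto simp: joinpaths_def linepath_def algebra_simps
        simp flip: scaleR_add_left)
  show "v4 \<noteq> v1"
    using inj[of "29/32" "15/16"] by (auto simp: joinpaths_def linepath_def algebra_simps
        simp flip: scaleR_add_left)
qed

lemma mat_K_vec_s:
  assumes "invertible (mat_K v1 v2 v3 v4)"
  shows "mat_K v1 v2 v3 v4 *v vec_s v1 v2 v3 v4 = vec_d v1 v2 v3 v4"
proof -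
  have "mat_K v1 v2 v3 v4 ** matrix_inv (mat_K v1 v2 v3 v4) = mat 1"
    using assms unfolding matrix_inv_def invertible_def by (rule someI2_ex) simp
  then show ?thesis
    by (simp add: vec_s_def matrix_vector_mul_assoc)
qed

lemma int_vertex_simps:
  "int_vertex s 0 = vector [1 - s $ 1, -1 - s $ 2]"
  "int_vertex s 1 = vector [1 + s $ 1, 1 + s $ 2]"
  "int_vertex s (Suc 0) = vector [1 + s $ 1, 1 + s $ 2]"
  "int_vertex s 2 = vector [-1 - s $ 1, 1 - s $ 2]"
  "int_vertex s 3 = vector [-1 + s $ 1, -1 + s $ 2]"
  "int_vertex s 4 = vector [1 - s $ 1, -1 - s $ 2]"
  by (simp_all add: int_vertex_def map_S_def ref_vertex_def vec_eq_iff forall_2)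

text \<open>
  The affine map with linear part \<open>mat_K\<close> sends the intermediate vertices to the original ones, so
  a collapsed edge would collapse an edge of the simple closed polygon.
\<close>

lemma int_vertices_distinct:
  assumes nd: "nondegenerate_quadrilateral v1 v2 v3 v4"
    and s: "s = vec_s v1 v2 v3 v4"
    and j: "j \<in> {1, 2, 3, 4}"
  shows "int_vertex s (j - 1) \<noteq> int_vertex s j"
proof
  assume eq: "int_vertex s (j - 1) = int_vertex s j"
  have "mat_K v1 v2 v3 v4 *v s = vec_d v1 v2 v3 v4"
    using nd s mat_K_vec_s by (simp add: nondegenerate_quadrilateral_def)
  then have As: "(v1 - v2 - v3 + v4) $ i * s $ 1 + (v1 + v2 - v3 - v4) $ i * s $ 2
      = (v1 - v2 + v3 - v4) $ i" for i
    by (simp add: mat_K_def vec_d_def vec_eq_iff matrix_vector_mult_def transpose_def sum_2)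
  have "v1 \<noteq> v2" "v2 \<noteq> v3" "v3 \<noteq> v4" "v4 \<noteq> v1"
    using nd linepath_joins_distinct_vertices[of v1 v2 v3 v4] by (auto simp: nondegenerate_quadrilateral_def)
  \<comment> \<open>Edge \<open>j\<close> collapses only for one specific \<open>s\<close>, plus or
    minus a unit vector. Then \<open>As\<close> equates \<open>vec_d\<close> with plus or minus a
    column of \<open>mat_K\<close>, which forces two adjacent vertices of the original quadrilateral
    to coincide.\<close>
  moreover have "(s $ 1 = 0 \<and> s $ 2 = -1 \<and> j = 1) \<or> (s $ 1 = -1 \<and> s $ 2 = 0 \<and> j = 2)
      \<or> (s $ 1 = 0 \<and> s $ 2 = 1 \<and> j = 3) \<or> (s $ 1 = 1 \<and> s $ 2 = 0 \<and> j = 4)"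
    using j eq by (auto simp: int_vertex_simps vec_eq_iff forall_2)
  ultimately show False
    using As by (auto simp: vec_eq_iff algebra_simps)
qed

lemma arclength_integral_linepath:
  "arclength_integral (linepath a b) f = dist a b * integral {0..1} (\<lambda>t. f (linepath a b t))"
proof -
  have "vector_derivative (linepath a b) (at t) = b - a" for t
    by (rule vector_derivative_at) (rule has_vector_derivative_linepath_within)
  then show ?thesis
    by (simp add: arclength_integral_def dist_norm norm_minus_commute mult.commute)
qed

lemma has_integral_bubble_quadratic:
  fixes q0 q1 q2 :: real
  shows "((\<lambda>u. (1 - (2 * u - 1)\<^sup>2) * (q0 + q1 * (2 * u - 1) + q2 * (2 * u - 1)\<^sup>2))
    has_integral 2 * q0 / 3 + 2 * q2 / 15) {0..1}"
proof -
  \<comment> \<open>Termwise antiderivative of the product expanded in powers of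
    \<open>2 * u - 1\<close>; the outer division by 2 accounts for the inner derivative 2. Its even
    powers agree at both ends, so \<open>q1\<close> drops out.\<close>
  define F where "F = (\<lambda>u::real. (q0 * (2 * u - 1) + q1 * (2 * u - 1)^2 / 2
    + (q2 - q0) * (2 * u - 1)^3 / 3 - q1 * (2 * u - 1)^4 / 4 - q2 * (2 * u - 1)^5 / 5) / 2)"
  have "((\<lambda>u. (1 - (2 * u - 1)\<^sup>2) * (q0 + q1 * (2 * u - 1) + q2 * (2 * u - 1)\<^sup>2))
    has_integral F 1 - F 0) {0..1}"
  proof (rule fundamental_theorem_of_calculus)
    fix u :: real
    have "(F has_real_derivative
        (1 - (2 * u - 1)\<^sup>2) * (q0 + q1 * (2 * u - 1) + q2 * (2 * u - 1)\<^sup>2)) (at u within {0..1})"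
      unfolding F_def by (rule derivative_eq_intros refl | simp)+ algebra
    then show "(F has_vector_derivative
        (1 - (2 * u - 1)\<^sup>2) * (q0 + q1 * (2 * u - 1) + q2 * (2 * u - 1)\<^sup>2)) (at u within {0..1})"
      by (simp add: has_real_derivative_iff_has_vector_derivative)
  qed simp
  then show ?thesis
    by (simp add: F_def add_divide_distrib diff_divide_distrib add.commute)
qed

lemma has_integral_linepath_coordinate:
  fixes a b :: "real^'n"
  shows "((\<lambda>t. linepath a b t $ i) has_integral midpoint a b $ i) {0..1}"
proof -
  have "((\<lambda>t. a $ i + (b $ i - a $ i) * t) has_integral
      (a $ i + (b $ i - a $ i) * (1/2))) {0..1}"
    using has_integral_const_real[of "a $ i" 0 1]
      has_integral_mult_right[OF ident_has_integral[of 0 "1::real"], of "b $ i - a $ i"]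
    by (auto intro!: has_integral_add)
  then show ?thesis
    by (simp add: linepath_def midpoint_def field_simps)
qed

text \<open>Setting \<tau> = 0 shows that the midpoints do not depend on \<open>s\<close>; the
  coefficients of \<tau> form half the edge vector.\<close>

lemma int_edge_coordinates:
  defines "\<tau> \<equiv> \<lambda>u::real. 2 * u - 1"
  shows "int_edge s 1 u = vector [1 + \<tau> u * s $ 1, \<tau> u * (1 + s $ 2)]"
    "int_edge s 2 u = vector [- (\<tau> u * (1 + s $ 1)), 1 - \<tau> u * s $ 2]"
    "int_edge s 3 u = vector [-1 + \<tau> u * s $ 1, \<tau> u * (s $ 2 - 1)]"
    "int_edge s 4 u = vector [\<tau> u * (1 - s $ 1), -1 - \<tau> u * s $ 2]"
  by (simp_all add: int_edge_def linepath_def int_vertex_simps vec_eq_iff forall_2 \<tau>_def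
      algebra_simps)

lemma mu_edge:
  assumes "j \<in> {1, 2, 3, 4}"
  obtains k q0 q1 where
    "\<And>u. mu s c (int_edge s j u) =
      k * ((1 - (2 * u - 1)\<^sup>2) * (q0 + q1 * (2 * u - 1) + 5/2 * q0 * (2 * u - 1)\<^sup>2))"
    "mu s c (int_midpoint s j) = k * q0"
proof -
  have mid: "int_midpoint s j = int_edge s j (1/2)"
    by (simp add: int_midpoint_def int_edge_def midpoint_def linepath_def algebra_simps)
  \<comment> \<open>\<open>ell1\<close> vanishes at vertices 1 and 3, \<open>ell2\<close> at
    vertices 2 and 4, and every edge joins one vertex of each pair. The witness \<open>k\<close> is
    the value of the product at the midpoint of the edge.\<close>
  have "\<exists>k. \<forall>u. ell1 s (int_edge s j u) * ell2 s (int_edge s j u) = k * (1 - (2 * u - 1)\<^sup>2)"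
  proof -
    consider "j = 1" | "j = 2" | "j = 3" | "j = 4" using assms by auto
    then show ?thesis
    proof cases
      case 1
      show ?thesis
        by (rule exI[of _ "(1 - s $ 1 + s $ 2) * (1 + s $ 1 + s $ 2)"])
          (unfold 1 ell1_def ell2_def int_edge_coordinates vector_2, algebra)
    next
      case 2
      show ?thesis
        by (rule exI[of _ "- (1 + s $ 1 - s $ 2) * (1 + s $ 1 + s $ 2)"])
          (unfold 2 ell1_def ell2_def int_edge_coordinates vector_2, algebra)
    next
      case 3
      show ?thesis
        by (rule exI[of _ "(1 + s $ 1 - s $ 2) * (1 - s $ 1 - s $ 2)"])
          (unfold 3 ell1_def ell2_def int_edge_coordinates vector_2, algebra)
    next
      case 4
      show ?thesis
        by (rule exI[of _ "- (1 - s $ 1 + s $ 2) * (1 - s $ 1 - s $ 2)"])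
          (unfold 4 ell1_def ell2_def int_edge_coordinates vector_2, algebra)
    qed
  qed
  then obtain k where ell: "\<And>u. ell1 s (int_edge s j u) * ell2 s (int_edge s j u)
      = k * (1 - (2 * u - 1)\<^sup>2)"
    by blast
  define q0 where "q0 = quad_Q s c (int_edge s j (1/2))"
  define q1 where "q1 = (quad_Q s c (int_edge s j 1) - quad_Q s c (int_edge s j 0)) / 2"
  \<comment> \<open>The restriction is quadratic in \<tau>, with \<open>q0\<close> its midpoint
    value and \<open>q1\<close> half the difference of its end values. On edge 1 the coefficient of
    \<tau> squared is \<open>(s $ 1)^2 + (1 + s $ 2)^2 + c * s $ 1 * (1 + s $ 2)\<close>, which is
    \<open>5/2 * q0\<close>; the other edges are analogous.\<close>
  have Q: "quad_Q s c (int_edge s j u) = q0 + q1 * (2 * u - 1) + 5/2 * q0 * (2 * u - 1)\<^sup>2" for u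
  proof -
    define t where "t = 2 * u - 1"
    show ?thesis
      using assms unfolding q0_def q1_def
      by (elim insertE emptyE; simp add: quad_Q_def r_squared_def int_edge_coordinates[unfolded One_nat_def]
          flip: t_def; simp add: field_simps power2_eq_square)
  qed
  show ?thesis
  proof (rule that[of "- 5/3 * k" q0 q1])
    show mu: "mu s c (int_edge s j u) = - 5/3 * k *
      ((1 - (2 * u - 1)\<^sup>2) * (q0 + q1 * (2 * u - 1) + 5/2 * q0 * (2 * u - 1)\<^sup>2))" for u
      using ell[of u] by (simp add: mu_def Q mult.assoc)
    show "mu s c (int_midpoint s j) = - 5/3 * k * q0"
      by (simp add: mid mu)
  qed
qed

text \<open>The property is linear in \<open>p\<close>, so the four generators suffice. Using
  \<open>has_integral\<close> carries integrability through the sums.\<close>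

lemma space_P_has_integral_edge:
  assumes "p \<in> space_P s c" and j: "j \<in> {1, 2, 3, 4}"
  shows "((\<lambda>u. p (int_edge s j u)) has_integral p (int_midpoint s j)) {0..1}"
  using assms(1) unfolding space_P_def
proof (rule real_fun.span_induct)
  show "real_fun.subspace
      {p. ((\<lambda>u. p (int_edge s j u)) has_integral p (int_midpoint s j)) {0..1}}"
    by (auto simp: real_fun.subspace_def intro: has_integral_add has_integral_mult_right)
next
  fix f assume "f \<in> {\<lambda>x. 1, \<lambda>x. x $ 1, \<lambda>x. x $ 2, mu s c}"
  moreover have "((\<lambda>u. mu s c (int_edge s j u)) has_integral mu s c (int_midpoint s j)) {0..1}"
  proof -
    obtain k q0 q1 where mu: "\<And>u. mu s c (int_edge s j u) =
        k * ((1 - (2 * u - 1)\<^sup>2) * (q0 + q1 * (2 * u - 1) + 5/2 * q0 * (2 * u - 1)\<^sup>2))"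
      and mid: "mu s c (int_midpoint s j) = k * q0"
      using mu_edge[OF j, of s c] by metis
    show ?thesis
      using has_integral_mult_right[OF has_integral_bubble_quadratic[of q0 q1 "5/2 * q0"], of k]
      by (simp add: mu mid)
  qed
  ultimately show "((\<lambda>u. f (int_edge s j u)) has_integral f (int_midpoint s j)) {0..1}"
    using has_integral_const_real[of "1::real" 0 1]
    by (auto simp: int_edge_def int_midpoint_def has_integral_linepath_coordinate)
qed

theorem mainTheorem2:
  fixes v1 v2 v3 v4 s :: "real^2" and c :: real and p :: "real^2 \<Rightarrow> real" and j :: nat
  assumes "nondegenerate_quadrilateral v1 v2 v3 v4"
    and "s = vec_s v1 v2 v3 v4"
    and "p \<in> space_P s c"
    and "j \<in> {1, 2, 3, 4}"
  shows "1 / int_edge_length s j * arclength_integral (int_edge s j) p = p (int_midpoint s j)"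
proof -
  \<comment> \<open>Since \<open>1 / 0 = 0\<close>, a collapsed edge would make the left side 0;
    nondegeneracy enters here to exclude this.\<close>
  have "int_edge_length s j \<noteq> 0"
    using int_vertices_distinct[OF assms(1,2,4)] by (simp add: int_edge_length_def)
  moreover have "arclength_integral (int_edge s j) p = int_edge_length s j * p (int_midpoint s j)"
    using integral_unique[OF space_P_has_integral_edge[OF assms(3,4)]]
    by (simp add: int_edge_def int_edge_length_def arclength_integral_linepath)
  ultimately show ?thesis
    by simp
qed

end
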